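(* If $N$ is a positive integer, then the $2N$th cyclotomic polynomial $\Phi_{2N}$ divides $F_N$.
   Context: $\mathcal P$ denotes the set of odd primes and $\chi_{\mathcal P}:\mathbb N\to\{0,1\}$ is its indicator function. For each positive integer $N$, the polynomial $F_N\in\mathbb Z[z]$ is $F_N(z)=\sum_{k=0}^{N-1}\left(\sum_{n=1}^{N-1}\chi_{\mathcal P}(n)z^{kn}\right)^2$. Divisibility is in $\mathbb Z[z]$. *)

theory Defs
  imports
    Complex_Main
    "HOL-Computational_Algebra.Polynomial"
    "HOL-Computational_Algebra.Primes"
    "HOL-Library.Indicator_Function"
    "HOL-Number_Theory.Totient"
begin

definition cyclotomic_complex :: "nat \<Rightarrow> complex poly" where
  "cyclotomic_complex n = (\<Prod>k\<in>totatives n. [:- cis (2 * pi * real k / real n), 1:])"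

text \<open>
  The polynomial over the integers with the same coefficients as \<^const>\<open>cyclotomic_complex\<close>;
  that it exists is lemma \<open>of_int_cyclotomic\<close> below.
\<close>
definition cyclotomic :: "nat \<Rightarrow> int poly" where
  "cyclotomic n = (THE p. map_poly of_int p = cyclotomic_complex n)"

definition odd_primes :: "nat set" where
  "odd_primes = {p. prime p \<and> odd p}"

definition F :: "nat \<Rightarrow> int poly" where
  "F N = (\<Sum>k\<in>{0..<N}. (\<Sum>n\<in>{1..<N}. monom (indicator odd_primes n) (k * n)) ^ 2)"


lemma prod_linear_roots_unity:
  assumes n: "n > 0"
  shows "(\<Prod>k\<in>{0<..n}. [:- cis (2 * pi * real k / real n), 1:]) = monom 1 n - 1"
proof -
  define g where "g = (\<lambda>k. [:- cis (2 * pi * real k / real n), 1:])"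
  have "(\<Prod>k\<in>{0<..n}. g k) = (\<Prod>k\<in>{..<n}. g k)"
  proof -
    have "{0<..n} = insert n {0<..<n}" "{..<n} = insert 0 {0<..<n}" using n by auto
    moreover have "g n = g 0" using n by (simp add: g_def)
    ultimately show ?thesis by simp
  qed
  also have "\<dots> = (\<Prod>z\<in>{z. z ^ n = 1}. [:- z, 1:])"
    unfolding g_def
    by (rule prod.reindex_bij_betw[OF Complex.bij_betw_roots_unity[OF n], where g = "\<lambda>z. [:- z, 1:]"])
  also have "\<dots> = monom 1 n - 1"
  proof (rule poly_eqI_degree_lead_coeff[where A = "{z::complex. z ^ n = 1}" and n = n])
    have fin: "finite {z::complex. z ^ n = 1}" using n by (intro finite_roots_unity) auto
    have card: "card {z::complex. z ^ n = 1} = n" using n by (rule card_roots_unity_eq)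
    have deg: "degree (\<Prod>z\<in>{z::complex. z ^ n = 1}. [:- z, 1:]) = n"
      by (subst degree_prod_sum_eq) (auto simp: card)
    have "lead_coeff (\<Prod>z\<in>{z::complex. z ^ n = 1}. [:- z, 1:]) = 1"
      by (simp add: lead_coeff_prod)
    then show "coeff (\<Prod>z\<in>{z::complex. z ^ n = 1}. [:- z, 1:]) n = coeff (monom 1 n - 1) n"
      using deg n by simp
    show "n \<le> card {z::complex. z ^ n = 1}" by (simp add: card)
    show "degree (\<Prod>z\<in>{z::complex. z ^ n = 1}. [:- z, 1:]) \<le> n" by (simp add: deg)
    show "degree (monom (1::complex) n - 1) \<le> n"
      by (intro degree_diff_le) (auto simp: degree_monom_le)
    show "poly (\<Prod>z\<in>{z::complex. z ^ n = 1}. [:- z, 1:]) z = poly (monom 1 n - 1) z"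
      if "z \<in> {z. z ^ n = 1}" for z
      using that fin by (auto simp: poly_prod poly_monom prod_zero_iff)
  qed
  finally show ?thesis unfolding g_def .
qed

lemma prod_cyclotomic_complex:
  assumes n: "n > 0"
  shows "(\<Prod>d | d dvd n. cyclotomic_complex d) = monom 1 n - 1"
proof -
  define g where "g = (\<lambda>k. [:- cis (2 * pi * real k / real n), 1:])"
  have fin: "finite {d. d dvd n}" using n by simp
  have inner: "(\<Prod>k\<in>{k \<in> {0<..n}. gcd k n = d}. g k) = cyclotomic_complex (n div d)"
    if d: "d dvd n" for d
  proof -
    have "(\<Prod>k\<in>{k \<in> {0<..n}. gcd k n = d}. g k) = (\<Prod>k\<in>totatives (n div d). g (k * d))"
      by (rule prod.reindex_bij_betw[OF bij_betw_totatives_gcd_eq[OF d n], symmetric])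
    also have "\<dots> = cyclotomic_complex (n div d)"
      unfolding cyclotomic_complex_def
    proof (rule prod.cong[OF refl])
      fix k
      from d n have "d > 0" by (auto intro: Nat.gr0I)
      with d have "real (k * d) / real n = real k / real (n div d)"
        by (auto simp: real_of_nat_div field_simps)
      then have "2 * pi * real (k * d) / real n = 2 * pi * real k / real (n div d)"
        by (metis times_divide_eq_right)
      then show "g (k * d) = [:- cis (2 * pi * real k / real (n div d)), 1:]"
        unfolding g_def by metis
    qed
    finally show ?thesis .
  qed
  have "(\<Prod>d | d dvd n. cyclotomic_complex d) = (\<Prod>d | d dvd n. cyclotomic_complex (n div d))"
    using n by (intro prod.reindex_bij_witness[where i = "\<lambda>d. n div d" and j = "\<lambda>d. n div d"]) auto
  also have "\<dots> = (\<Prod>d | d dvd n. \<Prod>k\<in>{k \<in> {0<..n}. gcd k n = d}. g k)"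
    by (rule prod.cong[OF refl], rule inner[symmetric]) simp
  also have "\<dots> = (\<Prod>k\<in>{0<..n}. g k)"
    by (rule prod.group) (use fin in auto)
  finally show ?thesis
    using prod_linear_roots_unity[OF n] by (simp add: g_def)
qed

lemma coeff_map_of_int: "coeff (map_poly of_int p) i = (of_int (coeff p i) :: complex)"
  by (simp add: coeff_map_poly)

lemma map_of_int_mult:
  "map_poly of_int (p * q) = (map_poly of_int p * map_poly of_int q :: complex poly)"
  by (rule poly_eqI) (simp add: coeff_map_of_int coeff_mult)

lemma map_of_int_prod:
  "map_poly of_int (\<Prod>x\<in>A. f x) = (\<Prod>x\<in>A. map_poly of_int (f x) :: complex poly)"
  by (induction A rule: infinite_finite_induct) (simp_all add: map_of_int_mult)

lemma map_of_int_inject: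
  "map_poly of_int p = (map_poly of_int q :: complex poly) \<longleftrightarrow> p = q"
  by (auto simp: poly_eq_iff coeff_map_of_int)

lemma lead_coeff_cyclotomic_complex: "lead_coeff (cyclotomic_complex n) = 1"
  by (simp add: cyclotomic_complex_def lead_coeff_prod)

lemma cyclotomic_complex_integral: "\<exists>p. map_poly of_int p = cyclotomic_complex n"
proof (induction n rule: less_induct)
  case (less n)
  show ?case
  proof (cases "n = 0")
    case True
    then show ?thesis by (intro exI[of _ 1]) (simp add: cyclotomic_complex_def)
  next
    case False
    then have n: "n > 0" by simp
    obtain c where c: "\<And>m. m < n \<Longrightarrow> map_poly of_int (c m) = cyclotomic_complex m"
      using less.IH by metis
    define D where "D = {d. d dvd n \<and> d \<noteq> n}"
    define P where "P = (\<Prod>d\<in>D. c d)"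
    define Pc where "Pc = (\<Prod>d\<in>D. cyclotomic_complex d)"
    have D: "{d. d dvd n} = insert n D" "n \<notin> D" "finite D"
      using n by (auto simp: D_def)
    have "d < n" if "d \<in> D" for d
      using that n by (auto simp: D_def dest: dvd_imp_le)
    then have P: "map_poly of_int P = Pc"
      unfolding P_def Pc_def map_of_int_prod by (intro prod.cong) (auto simp: c)
    have lcPc: "lead_coeff Pc = 1"
      by (simp add: Pc_def lead_coeff_prod lead_coeff_cyclotomic_complex)
    have degP: "degree Pc = degree P"
      unfolding P[symmetric] by (rule degree_map_poly) auto
    have lcP: "lead_coeff P = 1"
      using lcPc unfolding degP unfolding P[symmetric] coeff_map_of_int by simp
    then have P0: "P \<noteq> 0" by auto
    obtain q r where qr: "pseudo_divmod (monom 1 n - 1) P = (q, r)" by fastforce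
    have eq: "monom 1 n - 1 = P * q + r" and r: "r = 0 \<or> degree r < degree P"
      using pseudo_divmod[OF P0 qr] lcP by simp_all
    have "map_poly of_int (monom 1 n - 1) = (monom 1 n - 1 :: complex poly)"
      by (rule poly_eqI) (simp add: coeff_map_of_int coeff_monom one_pCons coeff_pCons split: nat.split)
    moreover have "map_poly of_int (P * q + r) = Pc * map_poly of_int q + map_poly of_int r"
      by (rule poly_eqI) (simp add: coeff_map_of_int flip: P map_of_int_mult)
    moreover have "monom 1 n - 1 = Pc * cyclotomic_complex n"
      using prod_cyclotomic_complex[OF n] D by (simp add: Pc_def mult.commute)
    ultimately have rr: "Pc * (cyclotomic_complex n - map_poly of_int q) = map_poly of_int r"
      using eq by (simp add: algebra_simps)
    have "cyclotomic_complex n - map_poly of_int q = 0"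
    proof (rule ccontr)
      assume nz: "cyclotomic_complex n - map_poly of_int q \<noteq> 0"
      have Pc0: "Pc \<noteq> 0" using lcPc by auto
      have "degree Pc \<le> degree (map_poly of_int r :: complex poly)"
        unfolding rr[symmetric] using nz Pc0 by (simp add: degree_mult_eq)
      also have "\<dots> = degree r" by (rule degree_map_poly) auto
      finally have "r = 0" using r degP by auto
      with rr nz Pc0 show False by simp
    qed
    then show ?thesis by (intro exI[of _ q]) simp
  qed
qed

lemma of_int_cyclotomic: "map_poly of_int (cyclotomic n) = cyclotomic_complex n"
proof -
  have "\<exists>!p. map_poly of_int p = cyclotomic_complex n"
    using cyclotomic_complex_integral[of n] by (metis map_of_int_inject)
  then show ?thesis unfolding cyclotomic_def by (rule theI')
qed

end

theory Submission
  imports Defs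
begin

text \<open>
  Let \<open>z\<close> be a primitive \<open>2N\<close>th root of unity. Expanding the square,
  \<open>F\<^sub>N(z)\<close> is the sum over pairs of odd primes \<open>p, q < N\<close> of the geometric sums
  \<open>\<Sum>k<N. (z ^ (p + q)) ^ k\<close>. As \<open>p + q\<close> is even, \<open>z ^ (p + q)\<close> is an \<open>N\<close>th root of unity,
  and as \<open>0 < p + q < 2N\<close> it is not \<open>1\<close>, so every such sum vanishes.
  Hence \<open>F\<^sub>N\<close> vanishes at all roots of \<open>\<Phi>\<^sub>2\<^sub>N\<close>, which are simple, and divisibility
  descends from the complex numbers to the integers because \<open>\<Phi>\<^sub>2\<^sub>N\<close> is monic.
\<close>

text \<open>Linear factors are split off one at a time: at a further point \<open>f x\<close> the
  removed factor takes the value \<open>f x - f a\<close>, nonzero by injectivity, so the cofactor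
  inherits the root.\<close>

lemma prod_linear_dvd:
  fixes p :: "'a::idom poly"
  assumes "finite A" "inj_on f A" "\<And>x. x \<in> A \<Longrightarrow> poly p (f x) = 0"
  shows "(\<Prod>x\<in>A. [:- f x, 1:]) dvd p"
  using assms
proof (induction A arbitrary: p rule: finite_induct)
  case empty
  then show ?case by simp
next
  case (insert a A)
  obtain q where q: "p = [:- f a, 1:] * q"
    using insert.prems(2)[of a] by (auto simp: poly_eq_0_iff_dvd elim: dvdE)
  have "poly q (f x) = 0" if "x \<in> A" for x
  proof -
    have "f x \<noteq> f a" using that insert by (auto simp: inj_on_def)
    moreover have "poly p (f x) = 0" using that insert.prems(2) by blast
    ultimately show ?thesis by (simp add: q)
  qed
  then have "(\<Prod>x\<in>A. [:- f x, 1:]) dvd q"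
    using insert.prems(1) by (intro insert.IH) auto
  then show ?case
    unfolding prod.insert[OF insert.hyps] q by (intro mult_dvd_mono dvd_refl)
qed

lemma map_of_int_add:
  "map_poly of_int (p + q) = (map_poly of_int p + map_poly of_int q :: complex poly)"
  by (rule poly_eqI) (simp add: coeff_map_of_int)

lemma map_of_int_sum:
  "map_poly of_int (\<Sum>x\<in>A. f x) = (\<Sum>x\<in>A. map_poly of_int (f x) :: complex poly)"
  by (induction A rule: infinite_finite_induct) (simp_all add: map_of_int_add)

lemma map_of_int_power:
  "map_poly of_int (p ^ n) = (map_poly of_int p ^ n :: complex poly)"
  by (induction n) (simp_all add: map_of_int_mult)

text \<open>Since \<open>p\<close> is monic, pseudo-division scales \<open>q\<close> by
  \<open>1\<close> and is true division with remainder over the integers. Over the complex numbers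
  \<open>p\<close> divides that remainder, whose degree is too small unless it is
  \<open>0\<close>.\<close>

lemma monic_dvd_of_map_of_int_dvd:
  assumes monic: "lead_coeff p = 1"
    and dvd: "map_poly of_int p dvd (map_poly of_int q :: complex poly)"
  shows "p dvd q"
proof -
  let ?m = "map_poly of_int :: int poly \<Rightarrow> complex poly"
  have deg: "degree (?m u) = degree u" for u by (rule degree_map_poly) auto
  have p0: "p \<noteq> 0" using monic by auto
  obtain s r where sr: "pseudo_divmod q p = (s, r)" by fastforce
  have eq: "q = p * s + r" and r: "r = 0 \<or> degree r < degree p"
    using pseudo_divmod[OF p0 sr] monic by simp_all
  have "?m q = ?m p * ?m s + ?m r" by (simp add: eq map_of_int_add map_of_int_mult)
  with dvd have "?m p dvd ?m r" by (simp add: dvd_add_right_iff)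
  then have "r = 0"
    using r dvd_imp_degree_le[of "?m p" "?m r"] map_of_int_inject[of r 0] by (auto simp: deg)
  then show ?thesis by (simp add: eq)
qed

lemma lead_coeff_cyclotomic: "lead_coeff (cyclotomic n) = 1"
proof -
  have "degree (cyclotomic_complex n) = degree (cyclotomic n)"
    unfolding of_int_cyclotomic[symmetric] by (rule degree_map_poly) auto
  then have "(of_int (lead_coeff (cyclotomic n)) :: complex) = 1"
    by (metis lead_coeff_cyclotomic_complex of_int_cyclotomic coeff_map_of_int)
  then show ?thesis by simp
qed

text \<open>The roots of \<open>cyclotomic_complex n\<close> are pairwise distinct, so vanishing at
  each of them gives divisibility over the complex numbers, and monicity brings it back to the
  integers.\<close>

lemma cyclotomic_dvd_iff:
  assumes "n > 0"
  shows "cyclotomic n dvd p \<longleftrightarrow>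
    (\<forall>j\<in>totatives n. poly (map_poly of_int p) (cis (2 * pi * real j / real n)) = 0)"
    (is "_ \<longleftrightarrow> ?roots")
proof
  assume "cyclotomic n dvd p"
  then have "cyclotomic_complex n dvd map_poly of_int p"
    unfolding of_int_cyclotomic[symmetric] by (auto elim!: dvdE simp: map_of_int_mult)
  then show ?roots
    by (auto elim!: dvdE simp: cyclotomic_complex_def poly_prod prod_zero_iff)
next
  assume roots: ?roots
  have inj: "inj_on (\<lambda>j. cis (2 * pi * real j / real n)) (totatives n)"
  \<comment> \<open>The only totative of \<open>1\<close> is \<open>1\<close> itself, which lies
    outside \<open>{..<1}\<close>; on a singleton injectivity is trivial.\<close>
  proof (cases "n = 1")
    case False
    have "inj_on (\<lambda>j. cis (2 * pi * real j / real n)) {..<n}"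
      using Complex.bij_betw_roots_unity[OF assms] by (rule bij_betw_imp_inj_on)
    moreover have "totatives n \<subseteq> {..<n}"
      using False assms by (auto simp: totatives_less)
    ultimately show ?thesis by (rule inj_on_subset)
  qed simp
  have "cyclotomic_complex n dvd map_poly of_int p"
    unfolding cyclotomic_complex_def
    using inj roots by (intro prod_linear_dvd) auto
  then show "cyclotomic n dvd p"
    by (intro monic_dvd_of_map_of_int_dvd) (simp_all add: lead_coeff_cyclotomic of_int_cyclotomic)
qed

text \<open>The real part of the power is a cosine equal to \<open>1\<close>, so its angle is a
  multiple of \<open>2 * pi\<close>. Hence \<open>n\<close> divides \<open>s * j\<close>, and
  coprimality removes \<open>j\<close>.\<close>

lemma primitive_root_power_eq_1:
  assumes "n > 0" "coprime j n" and eq: "cis (2 * pi * real j / real n) ^ s = 1"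
  shows "n dvd s"
proof -
  have "cos (real s * (2 * pi * real j / real n)) = 1"
    using eq by (simp add: Complex.DeMoivre complex_eq_iff)
  then obtain m :: int where "real s * (2 * pi * real j / real n) = of_int m * 2 * pi"
    by (auto simp: cos_one_2pi_int)
  then have "real s * real j = of_int m * real n"
    using assms(1) by (simp add: field_simps)
  then have "real_of_int (int (s * j)) = real_of_int (m * int n)" by simp
  then have "int (s * j) = m * int n" by (simp only: of_int_eq_iff)
  then have "int n dvd int (s * j)" by simp
  then have "n dvd s * j" by (simp only: int_dvd_int_iff)
  with assms(2) show ?thesis by (simp add: coprime_dvd_mult_left_iff coprime_commute)
qed

text \<open>Moving the sum over \<open>k\<close> innermost exposes a geometric sum for each pair of
  primes.\<close>

lemma poly_F:
  "poly (map_poly of_int (F N)) (z :: complex) =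
    (\<Sum>p\<in>odd_primes \<inter> {1..<N}. \<Sum>q\<in>odd_primes \<inter> {1..<N}. \<Sum>k<N. (z ^ (p + q)) ^ k)"
proof -
  let ?A = "odd_primes \<inter> {1..<N}"
  have "poly (map_poly of_int (F N)) z =
      (\<Sum>k<N. (\<Sum>n\<in>{1..<N}. of_int (indicator odd_primes n) * z ^ (k * n)) ^ 2)"
    by (simp add: F_def map_of_int_sum map_of_int_power map_poly_monom poly_sum poly_monom
        atLeast0LessThan)
  also have "\<dots> = (\<Sum>k<N. (\<Sum>p\<in>?A. z ^ (k * p)) ^ 2)"
    by (intro sum.cong refl arg_cong[where f = "\<lambda>x. x ^ 2"] sum.mono_neutral_cong_right)
      (auto simp: indicator_def)
  also have "\<dots> = (\<Sum>k<N. \<Sum>p\<in>?A. \<Sum>q\<in>?A. (z ^ (p + q)) ^ k)"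
    by (simp add: power2_eq_square sum_product power_add power_mult_distrib
        power_mult[symmetric] mult.commute)
  also have "\<dots> = (\<Sum>p\<in>?A. \<Sum>k<N. \<Sum>q\<in>?A. (z ^ (p + q)) ^ k)"
    by (rule sum.swap)
  also have "\<dots> = (\<Sum>p\<in>?A. \<Sum>q\<in>?A. \<Sum>k<N. (z ^ (p + q)) ^ k)"
    by (intro sum.cong refl sum.swap)
  finally show ?thesis .
qed

theorem theorem1p3:
  fixes N :: nat
  assumes "N > 0"
  shows "cyclotomic (2 * N) dvd F N"
proof -
  have "poly (map_poly of_int (F N)) (cis (2 * pi * real j / real (2 * N))) = 0"
    if j: "j \<in> totatives (2 * N)" for j
  proof -
    define z where "z = cis (2 * pi * real j / real (2 * N))"
    have "z ^ (2 * N) = cis (2 * pi * real j)"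
      unfolding z_def Complex.DeMoivre using assms by (intro arg_cong[where f = cis]) simp
    then have root: "z ^ (2 * N) = 1" by (simp add: cis_multiple_2pi)
    have "(\<Sum>k<N. (z ^ (p + q)) ^ k) = 0"
      if pq: "p \<in> odd_primes \<inter> {1..<N}" "q \<in> odd_primes \<inter> {1..<N}" for p q
    proof -
      have "even (p + q)" using pq by (simp add: odd_primes_def)
      then obtain m where m: "p + q = 2 * m" by blast
      have "(z ^ (p + q)) ^ N = (z ^ (2 * N)) ^ m"
        unfolding m power_mult[symmetric] by (simp add: mult_ac)
      then have "(z ^ (p + q)) ^ N = 1" by (simp add: root)
      moreover have "z ^ (p + q) \<noteq> 1"
      proof
        assume "z ^ (p + q) = 1"
        then have "2 * N dvd p + q"
          unfolding z_def using assms j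
          by (intro primitive_root_power_eq_1) (auto simp: totatives_def)
        \<comment> \<open>Both primes lie strictly between \<open>0\<close> and \<open>N\<close>, so
          \<open>0 < p + q < 2 * N\<close>.\<close>
        then show False using pq by (auto dest: dvd_imp_le)
      qed
      ultimately show ?thesis by (simp add: geometric_sum)
    qed
    then show ?thesis unfolding poly_F z_def[symmetric] by (simp only: sum.neutral_const cong: sum.cong)
  qed
  with assms show ?thesis by (subst cyclotomic_dvd_iff) auto
qed

end
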